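(* Let $p$ be an odd prime with $p\equiv 2\pmod 3$, and let $$T_p=\left[\frac{1}{i^2-ij+j^2}\right]_{1\le i,j\le p-1},$$ a $(p-1)\times(p-1)$ matrix with rational entries. Then $2\det T_p$ is a quadratic residue modulo $p$.
   Context: The entries of $T_p$ are rational numbers whose denominators are not divisible by $p$, so $2\det T_p$ is a rational number that is a $p$-adic integer and may be reduced modulo $p$ to an element of $\mathbb{F}_p=\mathbb{Z}/p\mathbb{Z}$. A $p$-adic integer is called a quadratic residue modulo $p$ if its reduction modulo $p$ is a nonzero square in $\mathbb{F}_p$. *)

theory Defs
  imports
    "Jordan_Normal_Form.Determinant"
    "HOL-Number_Theory.Number_Theory"
begin

text \<open>Matrix indices in this library start at 0, so the entry at position (i, j) is the one
  at the 1-based position (i + 1, j + 1).\<close>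

definition T_mat :: "nat \<Rightarrow> rat mat" where
  "T_mat p = mat (p - 1) (p - 1)
     (\<lambda>(i, j). 1 / ((of_nat (i + 1))\<^sup>2 - of_nat (i + 1) * of_nat (j + 1) + (of_nat (j + 1))\<^sup>2))"

definition p_integral :: "nat \<Rightarrow> rat \<Rightarrow> bool" where
  "p_integral p x \<longleftrightarrow> \<not> int p dvd snd (quotient_of x)"

text \<open>The image in the integers modulo p of a p-integral rational number, represented by an
  integer in [0, p). For rationals that are not p-integral the value is meaningless.\<close>

definition rat_mod :: "nat \<Rightarrow> rat \<Rightarrow> int" where
  "rat_mod p x =
     (fst (quotient_of x) * modular_inverse (int p) (snd (quotient_of x))) mod int p"

text \<open>The predicate \<open>QuadRes\<close> also accepts 0, hence the separate nonvanishing condition.\<close>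

definition rat_quadratic_residue :: "nat \<Rightarrow> rat \<Rightarrow> bool" where
  "rat_quadratic_residue p x \<longleftrightarrow>
     p_integral p x \<and> rat_mod p x \<noteq> 0 \<and> QuadRes (int p) (rat_mod p x)"

end

theory Submission
  imports Defs
begin

text \<open>
  Write p = 6 t + 5 and N = p - 1. Modulo p, the function 3 / (x^2 - x + 1) on the nonzero residues
  is the polynomial with coefficients 1, 2, 1, -1, -2, -1, 1, ... (of period 6) in degrees below N:
  these solve a(k) = a(k-1) - a(k-2), so multiplying by x^2 - x + 1 leaves
  1 + x + 2 x^N - x^(N+1), which is 3 because x^N = 1.
  Hence the matrix [3 j^2 / (i^2 - i j + j^2)] is congruent to V * diag(a) * W with V = [i^k] and
  W = [j^(N-k)]. Power sums modulo p give W * V = -I, so the determinant is congruent to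
  the product of the a(k), which is -2 (-4)^t. Since 3^N and the product of the j^2 are squares,
  2 det T is (-4)^(t+1) up to squares, and -1 is a square modulo p if t is even.
\<close>

subsection \<open>Determinants and congruences\<close>

text \<open>The Leibniz formula makes the determinant an integer polynomial in the entries, and such
  polynomials respect congruences.\<close>

lemma det_cong_int:
  fixes A B :: "int mat"
  assumes "A \<in> carrier_mat n n" "B \<in> carrier_mat n n"
    and "\<And>i j. i < n \<Longrightarrow> j < n \<Longrightarrow> [A $$ (i, j) = B $$ (i, j)] (mod m)"
  shows "[det A = det B] (mod m)"
proof -
  have "[signof \<pi> * (\<Prod>i = 0..<n. A $$ (i, \<pi> i)) = signof \<pi> * (\<Prod>i = 0..<n. B $$ (i, \<pi> i))] (mod m)"
    if "\<pi> permutes {0..<n}" for \<pi>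
  proof (intro cong_mult cong_refl cong_prod assms(3))
    fix i assume "i \<in> {0..<n}"
    then show "i < n" "\<pi> i < n"
      using permutes_in_image[OF that, of i] by auto
  qed
  then show ?thesis
    unfolding det_def'[OF assms(1)] det_def'[OF assms(2)] by (intro cong_sum) auto
qed

text \<open>Every Leibniz term meets each row and each column exactly once, so all terms share the
  same factor. Taking \<open>c\<close> or \<open>d\<close> to be constantly 1 gives scaling of
  columns or rows alone.\<close>

lemma det_scale_rows_cols:
  fixes f :: "nat \<Rightarrow> nat \<Rightarrow> 'a :: comm_ring_1"
  shows "det (mat n n (\<lambda>(i, j). c i * d j * f i j))
    = (\<Prod>i<n. c i) * (\<Prod>j<n. d j) * det (mat n n (\<lambda>(i, j). f i j))"
proof -
  have "signof \<pi> * (\<Prod>i = 0..<n. mat n n (\<lambda>(i, j). c i * d j * f i j) $$ (i, \<pi> i))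
      = (\<Prod>i<n. c i) * (\<Prod>j<n. d j) * (signof \<pi> * (\<Prod>i = 0..<n. mat n n (\<lambda>(i, j). f i j) $$ (i, \<pi> i)))"
    if \<pi>: "\<pi> permutes {0..<n}" for \<pi>
  proof -
    have lt: "\<pi> i < n" if "i < n" for i
      using permutes_in_image[OF \<pi>, of i] that by auto
    have "(\<Prod>i = 0..<n. mat n n (\<lambda>(i, j). c i * d j * f i j) $$ (i, \<pi> i))
        = (\<Prod>i = 0..<n. c i * d (\<pi> i) * f i (\<pi> i))"
      by (intro prod.cong) (auto simp: lt)
    also have "\<dots> = (\<Prod>i = 0..<n. c i) * (\<Prod>i = 0..<n. d (\<pi> i)) * (\<Prod>i = 0..<n. f i (\<pi> i))"
      by (simp add: prod.distrib)
    also have "(\<Prod>i = 0..<n. d (\<pi> i)) = (\<Prod>j = 0..<n. d j)"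
      using prod.permute[OF \<pi>, of d] by (simp add: o_def)
    also have "(\<Prod>i = 0..<n. f i (\<pi> i)) = (\<Prod>i = 0..<n. mat n n (\<lambda>(i, j). f i j) $$ (i, \<pi> i))"
      by (intro prod.cong) (auto simp: lt)
    finally show ?thesis
      by (simp add: lessThan_atLeast0 mult_ac)
  qed
  then show ?thesis
    by (subst (1 2) det_def'[of _ n]) (auto simp: sum_distrib_left intro!: sum.cong)
qed

subsection \<open>Reduction of rationals modulo a prime\<close>

text \<open>Lets residues be computed from any fraction a/b with b prime to p, reduced or not.
  Cross-multiplying with the reduced form n/m gives \<open>n * b = a * m\<close>, so p dividing m
  would also divide n.\<close>

lemma rat_mod_of_fraction:
  assumes p: "prime p" and eq: "x * of_int b = of_int a" and b: "\<not> int p dvd b"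
  shows "p_integral p x" "[rat_mod p x * b = a] (mod int p)"
proof -
  obtain n m where q: "quotient_of x = (n, m)"
    by fastforce
  have m: "m > 0" and cop: "coprime n m" and x: "x = of_int n / of_int m"
    using q by (auto dest: quotient_of_denom_pos quotient_of_coprime quotient_of_div)
  have pp: "prime (int p)"
    using p by simp
  have "(of_int (n * b) :: rat) = of_int (a * m)"
    using eq m unfolding x by (simp add: field_simps)
  then have nb: "n * b = a * m"
    by (simp only: of_int_eq_iff)
  have pm: "\<not> int p dvd m"
  proof
    assume d: "int p dvd m"
    then have "int p dvd n * b"
      by (simp add: nb)
    then have "int p dvd n"
      using b pp prime_dvd_mult_iff by blast
    with d cop pp show False
      by (meson not_coprimeI not_prime_unit)
  qed
  then show "p_integral p x"
    by (simp add: p_integral_def q)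
  have cm: "coprime m (int p)"
    using pm pp by (meson coprime_commute prime_imp_coprime)
  have "[rat_mod p x * m = n * modular_inverse (int p) m * m] (mod int p)"
    unfolding rat_mod_def q by (intro cong_mult) (auto simp: cong_def)
  also have "[n * modular_inverse (int p) m * m = n * 1] (mod int p)"
    using cong_modular_inverse2[OF cm] unfolding mult.assoc by (intro cong_mult cong_refl)
  finally have "[rat_mod p x * m * b = n * 1 * b] (mod int p)"
    by (rule cong_scalar_right)
  then have "[m * (rat_mod p x * b) = m * a] (mod int p)"
    using nb by (simp add: mult_ac)
  then show "[rat_mod p x * b = a] (mod int p)"
    using cong_mult_lcancel[OF cm] by blast
qed

subsection \<open>Power sums modulo a prime\<close>

text \<open>Multiplication by a primitive root g permutes the nonzero residues, so the sum S
  satisfies S = g^m S modulo p, while g^m is not 1.\<close>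

lemma sum_power_cong_0:
  assumes p: "prime p" and m: "\<not> p - 1 dvd m"
  shows "[(\<Sum>x\<in>{1..<int p}. x ^ m) = 0] (mod int p)"
proof -
  obtain g where g: "residue_primroot p g"
    using prime_primitive_root_exists[of p] p prime_gt_1_nat[OF p] by auto
  then have cop: "coprime (int g) (int p)" and ord: "ord p g = p - 1"
    using p by (auto simp: residue_primroot_def totient_prime coprime_commute)
  let ?S = "\<Sum>x\<in>{1..<int p}. x ^ m"
  have "?S = (\<Sum>x\<in>{1..<int p}. (int g * x mod int p) ^ m)"
    by (rule sum.reindex_bij_betw[OF bij_betw_int_remainders_mult[OF cop], symmetric])
  also have "[\<dots> = (\<Sum>x\<in>{1..<int p}. (int g * x) ^ m)] (mod int p)"
    by (intro cong_sum cong_pow) (simp add: cong_def)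
  also have "(\<Sum>x\<in>{1..<int p}. (int g * x) ^ m) = int g ^ m * ?S"
    by (simp add: power_mult_distrib sum_distrib_left)
  finally have "int p dvd ?S - int g ^ m * ?S"
    by (simp add: cong_iff_dvd_diff)
  also have "?S - int g ^ m * ?S = (1 - int g ^ m) * ?S"
    by (simp add: algebra_simps)
  finally have "int p dvd 1 - int g ^ m \<or> int p dvd ?S"
    using p prime_dvd_mult_iff[of "int p"] by simp
  moreover have "\<not> int p dvd 1 - int g ^ m"
  proof
    assume "int p dvd 1 - int g ^ m"
    then have "[int g ^ m = 1] (mod int p)"
      by (simp add: cong_iff_dvd_diff dvd_diff_commute)
    then have "[g ^ m = 1] (mod p)"
      by (metis cong_int_iff of_nat_1 of_nat_power)
    then show False
      using m ord ord_divides by metis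
  qed
  ultimately show ?thesis
    by (simp add: cong_0_iff)
qed

lemma fermat_int:
  assumes "prime p" "\<not> int p dvd x"
  shows "[x ^ (p - 1) = 1] (mod int p)"
proof -
  define k where "k = nat (x mod int p)"
  have k: "int k = x mod int p"
    using assms(1) prime_gt_0_nat by (simp add: k_def)
  then have "\<not> p dvd k"
    using assms(2) by (metis dvd_mod_iff dvd_refl int_dvd_int_iff)
  then have "[int k ^ (p - 1) = 1] (mod int p)"
    using fermat_theorem[OF assms(1)] by (metis cong_int_iff of_nat_1 of_nat_power)
  moreover have "[x ^ (p - 1) = int k ^ (p - 1)] (mod int p)"
    unfolding k by (intro cong_pow) (simp add: cong_def)
  ultimately show ?thesis
    using cong_trans by blast
qed

text \<open>These are the entries of W * V. The exponent lies strictly between 0 and 2 (p - 1), so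
  it is a multiple of p - 1 only if it equals p - 1, that is, if k = l; then Fermat makes all p - 1
  summands 1.\<close>

lemma sum_power_cong:
  assumes p: "prime p" and l: "l < p - 1" and k: "k < p - 1"
  shows "[(\<Sum>j<p - 1. int (j + 1) ^ (p - 1 - k + l)) = (if k = l then - 1 else 0)] (mod int p)"
proof -
  have p1: "p > 1"
    using p prime_gt_1_nat by blast
  have "bij_betw (\<lambda>j. int (j + 1)) {..<p - 1} {1..<int p}"
    by (rule bij_betwI[where g = "\<lambda>x. nat x - 1"]) auto
  from sum.reindex_bij_betw[OF this, of "\<lambda>x. x ^ (p - 1 - k + l)"]
  have S: "(\<Sum>j<p - 1. int (j + 1) ^ (p - 1 - k + l)) = (\<Sum>x\<in>{1..<int p}. x ^ (p - 1 - k + l))" .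
  show ?thesis
  proof (cases "k = l")
    case True
    have "[(\<Sum>x\<in>{1..<int p}. x ^ (p - 1 - k + l)) = (\<Sum>x\<in>{1..<int p}. 1)] (mod int p)"
    proof (rule cong_sum)
      fix x assume "x \<in> {1..<int p}"
      then have "\<not> int p dvd x"
        by (auto dest: zdvd_imp_le)
      then show "[x ^ (p - 1 - k + l) = 1] (mod int p)"
        using fermat_int[OF p] True l by simp
    qed
    also have "(\<Sum>x\<in>{1..<int p}. 1) = int p - 1"
      using p1 by simp
    also have "[int p - 1 = - 1] (mod int p)"
      by (simp add: cong_iff_dvd_diff)
    finally show ?thesis
      using True S by simp
  next
    case False
    have "\<not> p - 1 dvd p - 1 - k + l"
    proof
      assume "p - 1 dvd p - 1 - k + l"
      then obtain c where c: "p - 1 - k + l = (p - 1) * c" ..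
      have "0 < (p - 1) * c" "(p - 1) * c < (p - 1) * 2"
        using k l c by linarith+
      then have "c = 1"
        by (auto simp del: mult_Suc_right)
      then show False
        using c k False by auto
    qed
    from sum_power_cong_0[OF p this] show ?thesis
      using False S by simp
  qed
qed

subsection \<open>The interpolating polynomial\<close>

text \<open>The power series coefficients of (1 + x) / (1 - x + x^2); the period is 6 because the
  roots of the denominator are primitive sixth roots of unity.\<close>

definition interp_coeff :: "nat \<Rightarrow> int" where
  "interp_coeff k = [1, 2, 1, -1, -2, -1] ! (k mod 6)"

text \<open>If P is the interpolating polynomial, this is y^N P(x/y), which avoids division and
  agrees with P(x/y) modulo p when N = p - 1 and p does not divide y.\<close>

definition interp_form :: "nat \<Rightarrow> int \<Rightarrow> int \<Rightarrow> int" where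
  "interp_form N x y = (\<Sum>k<N. interp_coeff k * x ^ k * y ^ (N - k))"

lemma interp_coeff_block:
  "interp_coeff (6 * t + 4) = -2" "interp_coeff (6 * t + 5) = -1" "interp_coeff (6 * t + 6) = 1"
  "interp_coeff (6 * t + 7) = 2" "interp_coeff (6 * t + 8) = 1" "interp_coeff (6 * t + 9) = -1"
proof -
  have "(6 * t + 4) mod 6 = 4" "(6 * t + 5) mod 6 = 5" "(6 * t + 6) mod 6 = 0"
    "(6 * t + 7) mod 6 = 1" "(6 * t + 8) mod 6 = 2" "(6 * t + 9) mod 6 = 3"
    by presburger+
  then show "interp_coeff (6 * t + 4) = -2" "interp_coeff (6 * t + 5) = -1"
    "interp_coeff (6 * t + 6) = 1" "interp_coeff (6 * t + 7) = 2"
    "interp_coeff (6 * t + 8) = 1" "interp_coeff (6 * t + 9) = -1"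
    by (simp_all add: interp_coeff_def)
qed

lemma interp_coeff_start:
  "interp_coeff 0 = 1" "interp_coeff 1 = 2" "interp_coeff 2 = 1" "interp_coeff 3 = -1"
  by (simp_all add: interp_coeff_def)

lemma lessThan_4: "{..<4} = {0, 1, 2, 3 :: nat}"
  by auto

lemma lessThan_block:
  "{..<6 * Suc t + 4} = insert (6 * t + 9) (insert (6 * t + 8) (insert (6 * t + 7)
     (insert (6 * t + 6) (insert (6 * t + 5) (insert (6 * t + 4) {..<6 * t + 4})))))"
  by auto

text \<open>The first four coefficients multiply to -2, and each further block of six contributes
  (-2)(-1)(1)(2)(1)(-1) = -4. The leading 2 is the one in 2 det T.\<close>

lemma prod_interp_coeff: "2 * (\<Prod>k<6 * t + 4. interp_coeff k) = (- 4) ^ (t + 1)"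
proof (induction t)
  case 0
  show ?case
    using interp_coeff_start by (simp add: lessThan_4)
next
  case (Suc t)
  have "2 * (\<Prod>k<6 * Suc t + 4. interp_coeff k) = - 4 * (2 * (\<Prod>k<6 * t + 4. interp_coeff k))"
    unfolding lessThan_block by (simp add: interp_coeff_block)
  with Suc show ?case
    by simp
qed

lemma interp_form_step:
  "interp_form (6 * Suc t + 4) x y = y ^ 6 * interp_form (6 * t + 4) x y
     + x ^ (6 * t + 4) * (- 2 * y ^ 6 - x * y ^ 5 + x\<^sup>2 * y ^ 4 + 2 * x ^ 3 * y ^ 3 + x ^ 4 * y\<^sup>2 - x ^ 5 * y)"
proof -
  have "(\<Sum>k<6 * t + 4. interp_coeff k * x ^ k * y ^ (6 * Suc t + 4 - k))
      = y ^ 6 * (\<Sum>k<6 * t + 4. interp_coeff k * x ^ k * y ^ (6 * t + 4 - k))"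
    unfolding sum_distrib_left
  proof (rule sum.cong)
    fix k assume "k \<in> {..<6 * t + 4}"
    then have e: "6 * Suc t + 4 - k = 6 + (6 * t + 4 - k)"
      by auto
    show "interp_coeff k * x ^ k * y ^ (6 * Suc t + 4 - k)
        = y ^ 6 * (interp_coeff k * x ^ k * y ^ (6 * t + 4 - k))"
      unfolding e power_add by (simp only: mult_ac)
  qed auto
  moreover have "interp_form (6 * Suc t + 4) x y
      = (\<Sum>k<6 * t + 4. interp_coeff k * x ^ k * y ^ (6 * Suc t + 4 - k))
        - 2 * x ^ (6 * t + 4) * y ^ 6 - x ^ (6 * t + 5) * y ^ 5 + x ^ (6 * t + 6) * y ^ 4
        + 2 * x ^ (6 * t + 7) * y ^ 3 + x ^ (6 * t + 8) * y\<^sup>2 - x ^ (6 * t + 9) * y"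
    unfolding interp_form_def by (subst lessThan_block) (simp add: interp_coeff_block)
  moreover have "x ^ (6 * t + 5) = x ^ (6 * t + 4) * x" "x ^ (6 * t + 6) = x ^ (6 * t + 4) * x\<^sup>2"
    "x ^ (6 * t + 7) = x ^ (6 * t + 4) * x ^ 3" "x ^ (6 * t + 8) = x ^ (6 * t + 4) * x ^ 4"
    "x ^ (6 * t + 9) = x ^ (6 * t + 4) * x ^ 5"
    by (simp_all add: power_add eval_nat_numeral)
  \<comment> \<open>Stating the identity for arbitrary \<open>S\<close> and \<open>X\<close> keeps
    the sum and the power with exponent 6 t + 4 opaque to the ring normalisation.\<close>
  moreover have "S - 2 * X * y ^ 6 - X * x * y ^ 5 + X * x\<^sup>2 * y ^ 4 + 2 * (X * x ^ 3) * y ^ 3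
      + X * x ^ 4 * y\<^sup>2 - X * x ^ 5 * y
    = S + X * (- 2 * y ^ 6 - x * y ^ 5 + x\<^sup>2 * y ^ 4 + 2 * x ^ 3 * y ^ 3 + x ^ 4 * y\<^sup>2 - x ^ 5 * y)"
    for S X :: int
    by (simp add: algebra_simps)
  ultimately show ?thesis
    unfolding interp_form_def by (simp only:)
qed

text \<open>An exact integer identity: the recurrence of the coefficients cancels all inner terms of
  the product, leaving two terms at each end.\<close>

lemma interp_form_mult:
  defines "N \<equiv> \<lambda>t. 6 * t + 4"
  shows "interp_form (N t) x y * (x\<^sup>2 - x * y + y\<^sup>2)
    = y ^ (N t + 2) + x * y ^ (N t + 1) + 2 * x ^ N t * y\<^sup>2 - x ^ (N t + 1) * y"
proof (induction t)
  case 0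
  have "interp_form 4 x y = y ^ 4 + 2 * x * y ^ 3 + x\<^sup>2 * y\<^sup>2 - x ^ 3 * y"
    using interp_coeff_start by (simp add: interp_form_def lessThan_4)
  then show ?case
    by (simp add: N_def) (simp add: algebra_simps eval_nat_numeral)
next
  case (Suc t)
  let ?Q = "x\<^sup>2 - x * y + y\<^sup>2"
  define X Y where "X = x ^ N t" and "Y = y ^ N t"
  have IH: "interp_form (N t) x y * ?Q = Y * y\<^sup>2 + x * Y * y + 2 * X * y\<^sup>2 - X * x * y"
    using Suc by (simp add: X_def Y_def power_add power2_eq_square mult_ac)
  have "interp_form (N (Suc t)) x y * ?Q = y ^ 6 * (interp_form (N t) x y * ?Q)
     + X * (- 2 * y ^ 6 - x * y ^ 5 + x\<^sup>2 * y ^ 4 + 2 * x ^ 3 * y ^ 3 + x ^ 4 * y\<^sup>2 - x ^ 5 * y) * ?Q"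
    unfolding N_def interp_form_step X_def by (simp only: distrib_right mult.assoc)
  also have "\<dots> = Y * y ^ 8 + x * Y * y ^ 7 + 2 * (X * x ^ 6) * y\<^sup>2 - X * x ^ 7 * y"
    unfolding IH by (simp add: algebra_simps eval_nat_numeral)
  also have "\<dots> = y ^ (N (Suc t) + 2) + x * y ^ (N (Suc t) + 1) + 2 * x ^ N (Suc t) * y\<^sup>2 - x ^ (N (Suc t) + 1) * y"
  proof -
    have "N (Suc t) = N t + 6"
      by (simp add: N_def)
    then have "x ^ N (Suc t) = X * x ^ 6" "y ^ (N (Suc t) + 2) = Y * y ^ 8"
      "y ^ (N (Suc t) + 1) = Y * y ^ 7" "x ^ (N (Suc t) + 1) = X * x ^ 7"
      by (simp_all add: X_def Y_def power_add eval_nat_numeral)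
    then show ?thesis
      by (simp only: mult.assoc)
  qed
  finally show ?case .
qed

text \<open>Fermat replaces x^N and y^N by 1 in the exact identity, and the two mixed terms x y
  cancel.\<close>

lemma interp_form_cong:
  assumes p: "prime p" "p = 6 * t + 5" and x: "\<not> int p dvd x" and y: "\<not> int p dvd y"
  shows "[interp_form (p - 1) x y * (x\<^sup>2 - x * y + y\<^sup>2) = 3 * y\<^sup>2] (mod int p)"
proof -
  let ?N = "p - 1"
  have N: "?N = 6 * t + 4"
    using p by simp
  have "interp_form ?N x y * (x\<^sup>2 - x * y + y\<^sup>2)
      = y ^ ?N * y\<^sup>2 + x * (y ^ ?N * y) + 2 * x ^ ?N * y\<^sup>2 - x ^ ?N * x * y"
    unfolding interp_form_mult[of t x y, folded N]
    by (simp only: power_add power_one_right mult.assoc)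
  also have "[\<dots> = 1 * y\<^sup>2 + x * (1 * y) + 2 * 1 * y\<^sup>2 - 1 * x * y] (mod int p)"
    by (intro cong_add cong_diff cong_mult cong_refl fermat_int p x y)
  finally show ?thesis
    by (simp add: algebra_simps)
qed

lemma det_interp_form_cong:
  assumes p: "prime p" "odd p"
  shows "[det (mat (p - 1) (p - 1) (\<lambda>(i, j). interp_form (p - 1) (int (i + 1)) (int (j + 1))))
    = (\<Prod>k<p - 1. interp_coeff k)] (mod int p)"
proof -
  define N where "N = p - 1"
  define V where "V = mat N N (\<lambda>(i, k). int (i + 1) ^ k)"
  define W where "W = mat N N (\<lambda>(k, j). int (j + 1) ^ (N - k))"
  define B where "B = mat N N (\<lambda>(k, j). interp_coeff k * 1 * int (j + 1) ^ (N - k))"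
  have [simp]: "V \<in> carrier_mat N N" "W \<in> carrier_mat N N" "B \<in> carrier_mat N N"
    by (simp_all add: V_def W_def B_def)
  have "mat N N (\<lambda>(i, j). interp_form N (int (i + 1)) (int (j + 1))) = V * B"
    by (rule eq_matI) (auto simp: V_def B_def interp_form_def scalar_prod_def lessThan_atLeast0 mult_ac intro!: sum.cong)
  then have "det (mat N N (\<lambda>(i, j). interp_form N (int (i + 1)) (int (j + 1)))) = det V * det B"
    by (simp add: det_mult[of _ N])
  also have "det B = (\<Prod>k<N. interp_coeff k) * det W"
    unfolding B_def W_def det_scale_rows_cols by simp
  \<comment> \<open>Neither determinant is evaluated alone: in the order W * V the entries become
    power sums over the nonzero residues.\<close>
  also have "det V * ((\<Prod>k<N. interp_coeff k) * det W) = (\<Prod>k<N. interp_coeff k) * det (W * V)"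
    by (simp add: det_mult[of _ N])
  also have "[\<dots> = (\<Prod>k<N. interp_coeff k) * det ((- 1) \<cdot>\<^sub>m 1\<^sub>m N)] (mod int p)"
  proof (intro cong_mult cong_refl det_cong_int)
    fix k l assume kl: "k < N" "l < N"
    have "(W * V) $$ (k, l) = (\<Sum>j<N. int (j + 1) ^ (N - k + l))"
      using kl by (simp add: W_def V_def scalar_prod_def lessThan_atLeast0 flip: power_add)
    also have "[\<dots> = (if k = l then - 1 else 0)] (mod int p)"
      using sum_power_cong[OF p(1)] kl unfolding N_def by blast
    also have "(if k = l then - 1 else 0 :: int) = ((- 1) \<cdot>\<^sub>m 1\<^sub>m N) $$ (k, l)"
      using kl by simp
    finally show "[(W * V) $$ (k, l) = ((- 1) \<cdot>\<^sub>m 1\<^sub>m N) $$ (k, l)] (mod int p)" .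
  qed (auto intro: mult_carrier_mat[of _ N N])
  \<comment> \<open>The value is (-1)^N, and N = p - 1 is even.\<close>
  also have "det ((- 1) \<cdot>\<^sub>m 1\<^sub>m N :: int mat) = 1"
    using p(2) by (simp add: N_def)
  finally show ?thesis
    by (simp add: N_def)
qed

subsection \<open>The residue of the determinant\<close>

text \<open>For odd t the exponent is even. For even t, p is 1 modulo 4, so -1 is a square by
  Euler's criterion, and -4 is -1 times a square.\<close>

lemma QuadRes_neg_4_power:
  assumes p: "prime p" "p = 6 * t + 5"
  shows "QuadRes (int p) ((- 4) ^ (t + 1))"
proof (cases "even t")
  case False
  then obtain s where "t + 1 = 2 * s"
    by (metis even_plus_one_iff evenE)
  then have "((- 4) ^ s)\<^sup>2 = (- 4 :: int) ^ (t + 1)"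
    by (simp add: power_mult[symmetric] mult.commute)
  then show ?thesis
    unfolding QuadRes_def by (metis cong_refl)
next
  case True
  then have "even ((p - 1) div 2)"
    using p(2) by presburger
  then have "[Legendre (- 1) (int p) = 1] (mod int p)"
    using euler_criterion[of p "- 1"] p by simp
  \<comment> \<open>Since p > 2, the three possible Legendre values are told apart modulo p.\<close>
  moreover have "\<not> [- 1 = 1] (mod int p)" "\<not> [0 = 1] (mod int p)"
    using p(2) by (auto simp: cong_iff_dvd_diff dest: zdvd_imp_le)
  ultimately have "QuadRes (int p) (- 1)"
    unfolding Legendre_def by (auto split: if_splits)
  then obtain y where "[y\<^sup>2 = - 1] (mod int p)"
    unfolding QuadRes_def by blast
  then have "[(2 ^ (t + 1))\<^sup>2 * y\<^sup>2 = (2 ^ (t + 1))\<^sup>2 * - 1] (mod int p)"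
    by (intro cong_mult cong_refl)
  moreover have "(2 ^ (t + 1))\<^sup>2 * - 1 = (- 4 :: int) ^ (t + 1)"
    using True by (simp add: power_mult[symmetric] power2_eq_square flip: power_mult_distrib)
  ultimately show ?thesis
    unfolding QuadRes_def by (metis power_mult_distrib)
qed

theorem corollary1:
  fixes p :: nat
  assumes "prime p" and "odd p" and "[p = 2] (mod 3)"
  shows "rat_quadratic_residue p (2 * det (T_mat p))"
proof -
  have p: "prime (int p)"
    using assms by simp
  have "p mod 3 = 2"
    using assms(3) by (simp add: cong_def)
  then have "p mod 6 = 5"
    using assms(2) by presburger
  then have "p = 6 * (p div 6) + 5"
    by presburger
  then obtain t where t: "p = 6 * t + 5" ..
  define N where "N = p - 1"
  have N4: "N = 6 * t + 4"
    using t by (simp add: N_def)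
  define q :: "nat \<Rightarrow> nat \<Rightarrow> int"
    where "q i j = (int (i + 1))\<^sup>2 - int (i + 1) * int (j + 1) + (int (j + 1))\<^sup>2" for i j
  \<comment> \<open>A common denominator of row i of T, so scaling the rows by \<open>d\<close>
    turns T into the integer matrix \<open>A\<close>.\<close>
  define d where "d i = (\<Prod>j<N. q i j)" for i
  define D where "D = (\<Prod>i<N. d i)"
  define A where "A = mat N N (\<lambda>(i, j). d i div q i j)"
  define F where "F i j = interp_form N (int (i + 1)) (int (j + 1))" for i j
  have ndvd: "\<not> int p dvd int (i + 1)" if "i < N" for i
    using that dvd_imp_le[of p "i + 1"] unfolding int_dvd_int_iff N_def by auto
  have n3: "\<not> int p dvd 3"
    using t by (auto dest: zdvd_imp_le)
  have Fq: "[F i j * q i j = 3 * (int (j + 1))\<^sup>2] (mod int p)" if "i < N" "j < N" for i j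
    using interp_form_cong[OF assms(1) t ndvd ndvd] that unfolding F_def q_def N_def by blast
  \<comment> \<open>The right-hand side of \<open>Fq\<close> is a unit modulo p, so its factor
    \<open>q i j\<close> is one too. Hence all denominators of T are prime to p.\<close>
  have pq: "\<not> int p dvd q i j" if "i < N" "j < N" for i j
  proof
    assume "int p dvd q i j"
    then have "int p dvd 3 * (int (j + 1))\<^sup>2"
      using Fq[OF that] by (metis cong_dvd_iff dvd_mult)
    then show False
      using ndvd[OF that(2)] n3 p by (metis prime_dvd_mult_iff prime_dvd_power)
  qed
  have pd: "\<not> int p dvd d i" if "i < N" for i
    using that pq p by (auto simp: d_def prime_dvd_prod_iff)
  then have pD: "\<not> int p dvd D"
    using p by (auto simp: D_def prime_dvd_prod_iff)
  have Aq: "d i div q i j * q i j = d i" if "j < N" for i j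
    using that unfolding d_def by (intro dvd_div_mult_self dvd_prodI) auto

  have "of_int (det A) = det (map_mat rat_of_int A)"
    by simp
  also have "map_mat rat_of_int A = mat N N (\<lambda>(i, j). of_int (d i) * 1 * (1 / of_int (q i j)))"
  proof (rule eq_matI)
    fix i j assume "i < dim_row (mat N N (\<lambda>(i, j). of_int (d i) * 1 * (1 / rat_of_int (q i j))))"
      "j < dim_col (mat N N (\<lambda>(i, j). of_int (d i) * 1 * (1 / rat_of_int (q i j))))"
    then have ij: "i < N" "j < N"
      by auto
    then have "q i j \<noteq> 0"
      using pq by fastforce
    then show "map_mat rat_of_int A $$ (i, j)
        = mat N N (\<lambda>(i, j). of_int (d i) * 1 * (1 / rat_of_int (q i j))) $$ (i, j)"
      using ij arg_cong[OF Aq[OF ij(2), of i], of rat_of_int] by (simp add: A_def field_simps)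
  qed (auto simp: A_def)
  also have "det \<dots> = of_int D * det (mat N N (\<lambda>(i, j). 1 / rat_of_int (q i j)))"
    unfolding det_scale_rows_cols D_def by simp
  also have "mat N N (\<lambda>(i, j). 1 / rat_of_int (q i j)) = T_mat p"
    unfolding T_mat_def N_def q_def by (rule cong_mat) auto
  finally have "2 * det (T_mat p) * of_int D = of_int (2 * det A)"
    by simp
  note r = rat_mod_of_fraction[OF assms(1) this pD]

  \<comment> \<open>A square root of the product of the column factors 3 j^2 over 1-based j; the
    factor 3^N is a square because N is even.\<close>
  define s where "s = 3 ^ (N div 2) * (\<Prod>j<N. int (j + 1))"
  have ps: "\<not> int p dvd s"
    using p ndvd n3 prime_dvd_power[OF p, of 3 "N div 2"]
    by (auto simp: s_def prime_dvd_mult_iff prime_dvd_prod_iff)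
  have "even N"
    using assms(2) by (simp add: N_def)
  then have s2: "(\<Prod>j<N. 3 * (int (j + 1))\<^sup>2) = s\<^sup>2"
    by (simp add: s_def prod.distrib power_mult_distrib prod_power_distrib power_mult[symmetric])
  have "s\<^sup>2 * det A = det (mat N N (\<lambda>(i, j). 1 * (3 * (int (j + 1))\<^sup>2) * (d i div q i j)))"
    unfolding det_scale_rows_cols s2 A_def by simp
  also have "[\<dots> = det (mat N N (\<lambda>(i, j). d i * 1 * F i j))] (mod int p)"
  proof (rule det_cong_int)
    fix i j assume ij: "i < N" "j < N"
    \<comment> \<open>The entries are compared after multiplication by \<open>q i j\<close>, which
      undoes the integer division and can be cancelled modulo p.\<close>
    have "q i j * (1 * (3 * (int (j + 1))\<^sup>2) * (d i div q i j)) = d i * (3 * (int (j + 1))\<^sup>2)"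
      using Aq[OF ij(2), of i] by (metis mult.assoc mult.commute mult.left_neutral)
    also have "[\<dots> = d i * (F i j * q i j)] (mod int p)"
      by (rule cong_scalar_left[OF cong_sym[OF Fq[OF ij]]])
    also have "d i * (F i j * q i j) = q i j * (d i * 1 * F i j)"
      by simp
    finally have "[1 * (3 * (int (j + 1))\<^sup>2) * (d i div q i j) = d i * 1 * F i j] (mod int p)"
      using pq[OF ij] p by (metis cong_mult_lcancel coprime_commute prime_imp_coprime)
    then show "[mat N N (\<lambda>(i, j). 1 * (3 * (int (j + 1))\<^sup>2) * (d i div q i j)) $$ (i, j)
        = mat N N (\<lambda>(i, j). d i * 1 * F i j) $$ (i, j)] (mod int p)"
      using ij by simp
  qed auto
  also have "det (mat N N (\<lambda>(i, j). d i * 1 * F i j)) = D * det (mat N N (\<lambda>(i, j). F i j))"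
    unfolding det_scale_rows_cols D_def by simp
  also have "[\<dots> = D * (\<Prod>k<N. interp_coeff k)] (mod int p)"
    using det_interp_form_cong[OF assms(1,2)] unfolding F_def N_def by (rule cong_scalar_left)
  finally have detA: "[s\<^sup>2 * det A = D * (\<Prod>k<N. interp_coeff k)] (mod int p)" .

  define R where "R = rat_mod p (2 * det (T_mat p))"
  have "[(R * D) * s\<^sup>2 = (2 * det A) * s\<^sup>2] (mod int p)"
    using r(2) unfolding R_def by (rule cong_scalar_right)
  also have "(2 * det A) * s\<^sup>2 = 2 * (s\<^sup>2 * det A)"
    by simp
  also have "[\<dots> = 2 * (D * (\<Prod>k<N. interp_coeff k))] (mod int p)"
    by (rule cong_scalar_left[OF detA])
  also have "2 * (D * (\<Prod>k<N. interp_coeff k)) = D * (- 4) ^ (t + 1)"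
    unfolding prod_interp_coeff[of t, folded N4, symmetric] by (rule mult.left_commute)
  finally have "[D * (R * s\<^sup>2) = D * (- 4) ^ (t + 1)] (mod int p)"
    by (simp add: mult_ac)
  then have Rs: "[R * s\<^sup>2 = (- 4) ^ (t + 1)] (mod int p)"
    using pD p by (metis cong_mult_lcancel coprime_commute prime_imp_coprime)

  have "\<not> int p dvd (- 4) ^ (t + 1)"
  proof
    assume "int p dvd (- 4) ^ (t + 1)"
    then have "int p dvd - 4"
      using p prime_dvd_power by blast
    then show False
      using t by (auto dest: zdvd_imp_le)
  qed
  then have "R \<noteq> 0"
    using Rs by (auto simp: cong_0_iff dest: cong_sym)
  obtain y where y: "[y\<^sup>2 = (- 4) ^ (t + 1)] (mod int p)"
    using QuadRes_neg_4_power[OF assms(1) t] unfolding QuadRes_def by blast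
  have "coprime s (int p)"
    using ps p by (meson coprime_commute prime_imp_coprime)
  then obtain u where u: "[s * u = 1] (mod int p)"
    using cong_modular_inverse1 by blast
  \<comment> \<open>As u inverts s modulo p, y u is a square root of \<open>R\<close>.\<close>
  have "(y * u)\<^sup>2 = y\<^sup>2 * u\<^sup>2"
    by (simp add: power_mult_distrib)
  also have "[\<dots> = (R * s\<^sup>2) * u\<^sup>2] (mod int p)"
    by (rule cong_scalar_right[OF cong_trans[OF y cong_sym[OF Rs]]])
  also have "(R * s\<^sup>2) * u\<^sup>2 = R * (s * u)\<^sup>2"
    by (simp add: power_mult_distrib)
  also have "[\<dots> = R * 1\<^sup>2] (mod int p)"
    using u by (intro cong_mult cong_refl cong_pow)
  finally have "QuadRes (int p) R"
    unfolding QuadRes_def by auto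
  with r(1) \<open>R \<noteq> 0\<close> show ?thesis
    unfolding rat_quadratic_residue_def R_def by blast
qed

end
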